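(* Assume that every $y\in\mathcal Q$ satisfies $y\ge(1,\dots,1)$ componentwise. Consider the following procedure on input $y^*\in\mathbb R^p$ with $y^*\ge(1,\dots,1)$: compute an optimal extreme point solution $\widehat w\in\mathbb R^p$ of the problem $(\text{TSep-}y^* )$ $$\min\ (y^* )^{\mathsf T}w\quad\text{s.t.}\quad y^{\mathsf T}w\ge 1\ \ \forall y\in\mathcal Q,\qquad w_i\ge 0\ (i=1,\dots,p);$$ if $(y^* )^{\mathsf T}\widehat w<1$, return $(\textit{outside},H)$ with $H=\{y\in\mathbb R^p:\widehat w^{\mathsf T}y=1\}$; otherwise return $(\textit{inside},\emptyset)$. This procedure is a point separating oracle for $\mathcal Q^+$ (on such inputs $y^*$), and every hyperplane $H$ it returns is facet supporting for $\mathcal Q^+$.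
   Context: Setting: $p\in\mathbb N$, $\mathcal X$ is a set, $f\colon\mathcal X\to\mathbb R^p$, and one considers the multi-objective problem $\min f(x)$ s.t. $x\in\mathcal X$. Put $\mathcal Q:=f(\mathcal X)$ and let $\mathcal Q^+:=\mathrm{cl}\,\mathrm{conv}\,f(\mathcal X)+\mathbb R^p_{\ge 0}$ be the Edgeworth-Pareto hull, where $\mathbb R^p_{\ge 0}=\{y\in\mathbb R^p: y\ge 0\}$ (inequalities componentwise). Standing assumptions: (1) for every $w\in\mathbb Q^p_{\ge 0}$ the value $\inf\{w^{\mathsf T}f(x):x\in\mathcal X\}$ is computable and finite; (2) $\mathcal Q^+$ is finitely generated. Under these assumptions the paper takes $\mathcal Q^+$ to be a closed convex rational polyhedron with recession cone $\mathbb R^p_{\ge 0}$, and there is $y\in\mathbb R^p$ with $\mathcal Q^+\subseteq y+\mathbb R^p_{\ge 0}$. A point separating oracle for $\mathcal Q^+$ takes a point $y^*\in\mathbb R^p$ and returns: $(\textit{inside},\emptyset)$ if $y^*\in\mathcal Q^+$; and otherwise $(\textit{outside},H)$, where $H=\{y\in\mathbb R^p:w^{\mathsf T}y=\alpha\}$ is a supporting hyperplane of $\mathcal Q^+$ with $w^{\mathsf T}y^*<\alpha$ and $w^{\mathsf T}\widehat y\ge\alpha$ for all $\widehat y\in\mathcal Q^+$. A hyperplane $H=\{y: a^{\mathsf T}y=\beta\}$ supports a polyhedron $P$ in $F:=P\cap H$ if $F\neq\emptyset$ and $a^{\mathsf T}y\ge\beta$ for all $y\in P$. It is facet supporting for $P$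 if moreover $F$ is a facet, i.e. has affine dimension $\dim P-1$. In the paper, $(\text{TSep-}y^* )$ is solved by a cutting-plane approach in which the constraints $y^{\mathsf T}w\ge1$, $y\in\mathcal Q$, are separated by solving weighted-sum problems $\min\{w^{\mathsf T}f(x):x\in\mathcal X\}$. *)

theory Defs
  imports "HOL-Analysis.Analysis"
begin

definition nonneg_orthant :: "(real^'p) set" where
  "nonneg_orthant = {y. \<forall>i. 0 \<le> y $ i}"

definition EP_hull :: "'x set \<Rightarrow> ('x \<Rightarrow> real^'p) \<Rightarrow> (real^'p) set" where
  "EP_hull X f = closure (convex hull (f ` X)) + nonneg_orthant"

definition rational_vec :: "real^'p \<Rightarrow> bool" where
  "rational_vec w \<longleftrightarrow> (\<forall>i. w $ i \<in> \<rat>)"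

(* The infimum is taken in ereal, where the infimum over the empty set is \<infinity>;
   finiteness therefore includes that X is nonempty. *)
definition weighted_sums_finite :: "'x set \<Rightarrow> ('x \<Rightarrow> real^'p) \<Rightarrow> bool" where
  "weighted_sums_finite X f \<longleftrightarrow>
     (\<forall>w\<in>nonneg_orthant. rational_vec w \<longrightarrow> \<bar>INF x\<in>X. ereal (w \<bullet> f x)\<bar> \<noteq> \<infinity>)"

definition finitely_generated :: "(real^'p) set \<Rightarrow> bool" where
  "finitely_generated P \<longleftrightarrow>
     (\<exists>V R. finite V \<and> finite R \<and> P = convex hull V + convex_cone hull R)"

definition rational_polyhedron :: "(real^'p) set \<Rightarrow> bool" where
  "rational_polyhedron P \<longleftrightarrow>
     (\<exists>C. finite C \<and> (\<forall>(a, b)\<in>C. rational_vec a \<and> b \<in> \<rat>) \<and>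
          P = {y. \<forall>(a, b)\<in>C. a \<bullet> y \<ge> b})"

(* The hyperplane is {y. a \<bullet> y = b}, represented by its coefficients since the
   supporting condition depends on the orientation of the normal vector. *)
definition supporting_hyperplane :: "(real^'p) set \<Rightarrow> real^'p \<Rightarrow> real \<Rightarrow> bool" where
  "supporting_hyperplane P a b \<longleftrightarrow>
     a \<noteq> 0 \<and> P \<inter> {y. a \<bullet> y = b} \<noteq> {} \<and> (\<forall>y\<in>P. a \<bullet> y \<ge> b)"

definition facet_supporting :: "(real^'p) set \<Rightarrow> (real^'p) set \<Rightarrow> bool" where
  "facet_supporting P H \<longleftrightarrow>
     (\<exists>a b. H = {y. a \<bullet> y = b} \<and> supporting_hyperplane P a b) \<and> (P \<inter> H) facet_of P"

datatype verdict = Inside | Outside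

definition point_separating_oracle_on ::
  "(real^'p) set \<Rightarrow> (real^'p) set \<Rightarrow> (real^'p \<Rightarrow> verdict \<times> (real^'p) set) \<Rightarrow> bool" where
  "point_separating_oracle_on D P oracle_fn \<longleftrightarrow>
     (\<forall>ystar\<in>D.
        (ystar \<in> P \<longrightarrow> oracle_fn ystar = (Inside, {})) \<and>
        (ystar \<notin> P \<longrightarrow>
           (\<exists>w \<alpha>. oracle_fn ystar = (Outside, {y. w \<bullet> y = \<alpha>}) \<and>
                  supporting_hyperplane P w \<alpha> \<and>
                  w \<bullet> ystar < \<alpha> \<and> (\<forall>y\<in>P. w \<bullet> y \<ge> \<alpha>))))"

definition tsep_feasible :: "(real^'p) set \<Rightarrow> (real^'p) set" where
  "tsep_feasible Q = {w. (\<forall>y\<in>Q. y \<bullet> w \<ge> 1) \<and> (\<forall>i. 0 \<le> w $ i)}"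

definition tsep_optimal_extreme :: "(real^'p) set \<Rightarrow> real^'p \<Rightarrow> real^'p \<Rightarrow> bool" where
  "tsep_optimal_extreme Q ystar w \<longleftrightarrow>
     w extreme_point_of tsep_feasible Q \<and> (\<forall>v\<in>tsep_feasible Q. ystar \<bullet> w \<le> ystar \<bullet> v)"

(* The argument solve returns the point at which the linear program is solved for a
   given input; optimal extreme points need not be unique, so it is kept arbitrary. *)
definition tsep_procedure ::
  "(real^'p \<Rightarrow> real^'p) \<Rightarrow> real^'p \<Rightarrow> verdict \<times> (real^'p) set" where
  "tsep_procedure solve ystar =
     (let w = solve ystar
      in if ystar \<bullet> w < 1 then (Outside, {y. w \<bullet> y = 1}) else (Inside, {}))"

end

theory Submission
  imports Defs
begin

text \<open>
  The feasible region of the linear program is the set of \<open>w \<ge> 0\<close> with \<open>w \<bullet> y \<ge> 1\<close> on the whole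
  Edgeworth-Pareto hull, and it is cut out by finitely many of these inequalities, one for each
  generator \<open>v\<close> of the hull. A hyperplane strictly separating \<open>ystar \<ge> 1\<close> from the hull has a
  nonnegative normal and a positive right-hand side, so it can be rescaled to a feasible \<open>w\<close> with
  value below 1. At an extreme point \<open>w\<close>, no nonzero direction \<open>d\<close> is orthogonal to all tight
  generators and vanishes wherever \<open>w\<close> does. Since the face where \<open>w \<bullet> y = 1\<close> contains the tight
  generators and is invariant under adding the unit vectors on which \<open>w\<close> vanishes, a vector
  orthogonal to this face is such a direction. So the face spans the space and is a facet.
\<close>

section \<open>The feasible region and existence of optimal extreme points\<close>

lemma convex_tsep_feasible: "convex (tsep_feasible Q)"
proof -
  have "tsep_feasible Q = (\<Inter>y\<in>Q. {w. y \<bullet> w \<ge> 1}) \<inter> (\<Inter>i. {w. axis i 1 \<bullet> w \<ge> 0})"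
    by (auto simp: tsep_feasible_def inner_axis')
  then show ?thesis
    by (simp add: convex_INT convex_Int convex_halfspace_ge)
qed

lemma closed_tsep_feasible: "closed (tsep_feasible Q)"
proof -
  have "tsep_feasible Q = (\<Inter>y\<in>Q. {w. y \<bullet> w \<ge> 1}) \<inter> (\<Inter>i. {w. axis i 1 \<bullet> w \<ge> 0})"
    by (auto simp: tsep_feasible_def inner_axis')
  then show ?thesis
    by (simp add: closed_INT closed_Int closed_halfspace_ge)
qed

lemma axis_in_tsep_feasible:
  assumes "\<forall>y\<in>Q. 1 \<le> y $ i"
  shows "axis i 1 \<in> tsep_feasible Q"
  using assms by (simp add: tsep_feasible_def inner_axis) (simp add: axis_def)

lemma inner_nonneg_vec:
  fixes x y :: "real^'p"
  assumes "\<forall>i. 0 \<le> x $ i" and "\<forall>i. 0 \<le> y $ i"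
  shows "0 \<le> x \<bullet> y"
  using assms by (simp add: inner_vec_def sum_nonneg)

text \<open>The inner product dominates the l1 norm of \<open>w\<close>. This coercivity makes
  sublevel sets of the objective bounded.\<close>

lemma norm_le_inner_if_ge_one:
  fixes y w :: "real^'p"
  assumes "\<forall>i. 1 \<le> y $ i" and "\<forall>i. 0 \<le> w $ i"
  shows "norm w \<le> y \<bullet> w"
proof -
  have "norm w \<le> (\<Sum>i\<in>UNIV. \<bar>w $ i\<bar>)"
    by (rule norm_le_l1_cart)
  also have "\<dots> \<le> (\<Sum>i\<in>UNIV. y $ i * w $ i)"
  proof (rule sum_mono)
    fix i
    show "\<bar>w $ i\<bar> \<le> y $ i * w $ i"
      using assms mult_right_mono[of 1 "y $ i" "w $ i"] by simp
  qed
  finally show ?thesis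
    by (simp add: inner_vec_def)
qed

lemma tsep_optimal_extreme_exists:
  fixes ystar :: "real^'p"
  assumes "tsep_feasible Q \<noteq> {}" and ystar: "\<forall>i. 1 \<le> ystar $ i"
  shows "\<exists>w. tsep_optimal_extreme Q ystar w"
proof -
  let ?W = "tsep_feasible Q"
  have norm_le: "norm w \<le> ystar \<bullet> w" if "w \<in> ?W" for w
    using that ystar by (intro norm_le_inner_if_ge_one) (auto simp: tsep_feasible_def)
  obtain w0 where w0: "w0 \<in> ?W"
    using assms(1) by blast
  \<comment> \<open>The sublevel set through \<open>w0\<close> is compact, and every feasible point
    outside it has a larger value, so a minimum over it is a minimum over the whole region.\<close>
  let ?S = "?W \<inter> {w. ystar \<bullet> w \<le> ystar \<bullet> w0}"
  have "compact ?S"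
  proof -
    have "bounded ?S"
      unfolding bounded_iff using norm_le by (intro exI[of _ "ystar \<bullet> w0"]) force
    then show ?thesis
      by (simp add: compact_eq_bounded_closed closed_Int closed_tsep_feasible closed_halfspace_le)
  qed
  moreover have "?S \<noteq> {}"
    using w0 by blast
  moreover have "continuous_on ?S ((\<bullet>) ystar)"
    by (intro continuous_intros)
  ultimately obtain m where m: "m \<in> ?S" "\<And>v. v \<in> ?S \<Longrightarrow> ystar \<bullet> m \<le> ystar \<bullet> v"
    using continuous_attains_inf by metis
  have min: "ystar \<bullet> m \<le> ystar \<bullet> v" if "v \<in> ?W" for v
    using m that by force
  \<comment> \<open>The minimizers form a compact convex face. It has an extreme point, and an
    extreme point of a face is extreme in the whole region.\<close>
  let ?F = "?W \<inter> {w. ystar \<bullet> w = ystar \<bullet> m}"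
  have face: "?F face_of ?W"
    using min by (intro face_of_Int_supporting_hyperplane_ge convex_tsep_feasible)
  have "bounded ?F"
    unfolding bounded_iff using norm_le by (intro exI[of _ "ystar \<bullet> m"]) force
  then have "compact ?F"
    by (simp add: compact_eq_bounded_closed closed_Int closed_tsep_feasible closed_hyperplane)
  moreover have "convex ?F"
    using face face_of_imp_convex convex_tsep_feasible by blast
  ultimately obtain w where "w extreme_point_of ?F"
    using m(1) extreme_point_exists_convex by blast
  then have "w extreme_point_of ?W" "ystar \<bullet> w = ystar \<bullet> m"
    using extreme_point_of_face[OF face] by auto
  then show ?thesis
    using min unfolding tsep_optimal_extreme_def by auto
qed

section \<open>Extreme points of the feasible region induce facets\<close>

text \<open>Otherwise \<open>w\<close> is the midpoint of a nondegenerate segment with both ends in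
  \<open>S\<close>.\<close>

lemma extreme_point_perturbation:
  fixes w d :: "'a::real_vector"
  assumes "w extreme_point_of S" and "e > 0" and "w + e *\<^sub>R d \<in> S" and "w - e *\<^sub>R d \<in> S"
  shows "d = 0"
proof (rule ccontr)
  assume "d \<noteq> 0"
  have "midpoint (w - e *\<^sub>R d) (w + e *\<^sub>R d) = w"
    by (simp add: midpoint_eq_iff)
  moreover have "w - e *\<^sub>R d \<noteq> w + e *\<^sub>R d"
  proof
    assume "w - e *\<^sub>R d = w + e *\<^sub>R d"
    then have "e *\<^sub>R d + e *\<^sub>R d = 0"
      by (metis add_diff_cancel_left' diff_add_cancel add.assoc diff_self)
    then have "(e + e) *\<^sub>R d = 0"
      by (simp only: scaleR_add_left)
    then show False
      using \<open>d \<noteq> 0\<close> \<open>e > 0\<close> by simp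
  qed
  ultimately have "w \<in> open_segment (w - e *\<^sub>R d) (w + e *\<^sub>R d)"
    using midpoint_in_open_segment[of "w - e *\<^sub>R d" "w + e *\<^sub>R d"] by simp
  then show False
    using assms by (auto simp: extreme_point_of_def)
qed

text \<open>Constraints that are tight at \<open>w\<close> stay tight along \<open>d\<close>, and
  the slack ones tolerate a small step in either direction, so \<open>w\<close> can be moved both
  ways along \<open>d\<close>.\<close>

lemma tsep_feasible_extreme_direction:
  fixes w d :: "real^'p"
  assumes "finite V" and ext: "w extreme_point_of tsep_feasible V"
    and tight: "\<And>v. v \<in> V \<Longrightarrow> v \<bullet> w = 1 \<Longrightarrow> v \<bullet> d = 0"
    and zero: "\<And>i. w $ i = 0 \<Longrightarrow> d $ i = 0"
  shows "d = 0"
proof -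
  have w: "\<And>v. v \<in> V \<Longrightarrow> 1 \<le> v \<bullet> w" "\<And>i. 0 \<le> w $ i"
    using ext by (auto simp: extreme_point_of_def tsep_feasible_def)
  have slack: "\<forall>\<^sub>F e in at_right 0. \<bar>e * c\<bar> \<le> s" if "0 < s" for c s :: real
  proof -
    have "((\<lambda>e. \<bar>e * c\<bar>) \<longlongrightarrow> \<bar>0 * c\<bar>) (at_right 0)"
      by (intro tendsto_intros)
    then show ?thesis
      using that by (auto dest!: order_tendstoD(2)[of _ _ _ s] elim: eventually_mono)
  qed
  have "\<forall>\<^sub>F e in at_right 0. \<bar>e * (v \<bullet> d)\<bar> \<le> v \<bullet> w - 1" if "v \<in> V" for v
    using slack[of "v \<bullet> w - 1" "v \<bullet> d"] w(1)[OF that] tight[OF that] by (cases "v \<bullet> w = 1") auto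
  \<comment> \<open>Finiteness of \<open>V\<close> allows one step size for all generators at
    once.\<close>
  then have "\<forall>\<^sub>F e in at_right 0. \<forall>v\<in>V. \<bar>e * (v \<bullet> d)\<bar> \<le> v \<bullet> w - 1"
    using \<open>finite V\<close> by (simp add: eventually_ball_finite_distrib)
  moreover have "\<forall>\<^sub>F e in at_right 0. \<bar>e * d $ i\<bar> \<le> w $ i" for i
    using slack[of "w $ i" "d $ i"] w(2)[of i] zero[of i] by (cases "w $ i = 0") auto
  then have "\<forall>\<^sub>F e in at_right 0. \<forall>i. \<bar>e * d $ i\<bar> \<le> w $ i"
    by (simp add: eventually_all_finite)
  moreover have "\<forall>\<^sub>F e in at_right 0. (0::real) < e"
    by (simp add: eventually_at_right_less)
  ultimately have "\<forall>\<^sub>F e in at_right 0. 0 < e \<and>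
      (\<forall>v\<in>V. \<bar>e * (v \<bullet> d)\<bar> \<le> v \<bullet> w - 1) \<and> (\<forall>i. \<bar>e * d $ i\<bar> \<le> w $ i)"
    by eventually_elim simp
  from eventually_happens'[OF trivial_limit_at_right_real this]
  obtain e :: real where e: "0 < e" "\<And>v. v \<in> V \<Longrightarrow> \<bar>e * (v \<bullet> d)\<bar> \<le> v \<bullet> w - 1"
      "\<And>i. \<bar>e * d $ i\<bar> \<le> w $ i"
    by auto
  have feas: "w + t *\<^sub>R d \<in> tsep_feasible V" if t: "t = e \<or> t = - e" for t
  proof -
    have "1 \<le> v \<bullet> w + t * (v \<bullet> d)" if "v \<in> V" for v
      using e(2)[OF that] t by (auto simp: abs_le_iff)
    moreover have "0 \<le> w $ i + t * d $ i" for i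
      using e(3)[of i] t by (auto simp: abs_le_iff)
    ultimately show ?thesis
      by (simp add: tsep_feasible_def inner_add_right)
  qed
  have "w + e *\<^sub>R d \<in> tsep_feasible V" "w - e *\<^sub>R d \<in> tsep_feasible V"
    using feas[of e] feas[of "- e"] by auto
  then show ?thesis
    by (rule extreme_point_perturbation[OF ext e(1)])
qed

text \<open>Adding the origin turns affine dimension into linear dimension and raises it by at most
  one.\<close>

lemma aff_dim_ge_if_span_UNIV:
  fixes F :: "'a::euclidean_space set"
  assumes "span F = UNIV"
  shows "int DIM('a) - 1 \<le> aff_dim F"
proof -
  have "aff_dim (insert 0 F) = int (dim (insert 0 F))"
    by (intro aff_dim_zero hull_inc) simp
  moreover have "dim (insert 0 F) = DIM('a)"
    using assms by (metis dim_span dim_UNIV span_insert_0)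
  ultimately show ?thesis
    using aff_dim_insert[of 0 F] by (auto split: if_splits)
qed

text \<open>The span of the face bounds its dimension from below, and its being a proper face bounds
  it from above. The set \<open>V\<close> supplies the finite description of the feasible region on
  which the perturbation argument relies.\<close>

lemma tsep_extreme_facet_supporting:
  fixes P :: "(real^'p) set"
  assumes "convex P" and up: "\<And>y r. y \<in> P \<Longrightarrow> r \<in> nonneg_orthant \<Longrightarrow> y + r \<in> P"
    and "finite V" "V \<noteq> {}" "V \<subseteq> P" and feasible: "tsep_feasible P = tsep_feasible V"
    and ext: "w extreme_point_of tsep_feasible P"
  shows "supporting_hyperplane P w 1" and "facet_supporting P {y. w \<bullet> y = 1}"
proof -
  have w: "\<And>y. y \<in> P \<Longrightarrow> 1 \<le> w \<bullet> y" "\<And>i. 0 \<le> w $ i"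
    using ext by (auto simp: extreme_point_of_def tsep_feasible_def inner_commute)
  have direction: "d = 0" if "\<And>v. v \<in> V \<Longrightarrow> w \<bullet> v = 1 \<Longrightarrow> v \<bullet> d = 0"
      "\<And>i. w $ i = 0 \<Longrightarrow> d $ i = 0" for d
    using tsep_feasible_extreme_direction[OF \<open>finite V\<close>, of w d] ext that
    by (simp add: feasible inner_commute)
  have "w \<noteq> 0"
    using w(1) \<open>V \<noteq> {}\<close> \<open>V \<subseteq> P\<close> by force
  \<comment> \<open>Without a tight generator, the direction \<open>w\<close> itself would satisfy
    both conditions of \<open>direction\<close>, forcing \<open>w = 0\<close>.\<close>
  then obtain v0 where v0: "v0 \<in> V" "w \<bullet> v0 = 1"
    using direction[of w] by blast
  let ?F = "P \<inter> {y. w \<bullet> y = 1}"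
  show supp: "supporting_hyperplane P w 1"
    using v0 w(1) \<open>w \<noteq> 0\<close> \<open>V \<subseteq> P\<close> by (auto simp: supporting_hyperplane_def)
  have face: "?F face_of P"
    using w(1) by (intro face_of_Int_supporting_hyperplane_ge \<open>convex P\<close>)
  have "span ?F = UNIV"
  proof (rule ccontr)
    assume "span ?F \<noteq> UNIV"
    then obtain d where d: "d \<noteq> 0" "\<And>y. y \<in> span ?F \<Longrightarrow> d \<bullet> y = 0"
      using span_not_UNIV_orthogonal[of ?F] by blast
    have orth: "d \<bullet> y = 0" if "y \<in> ?F" for y
      by (rule d(2)[OF span_base[OF that]])
    have "d $ i = 0" if "w $ i = 0" for i
    proof -
      have "axis i 1 \<in> (nonneg_orthant :: (real^'p) set)"
        by (simp add: nonneg_orthant_def axis_def)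
      \<comment> \<open>Both \<open>v0\<close> and \<open>v0 + axis i 1\<close> lie in the face, so
        orthogonality to their difference gives \<open>d $ i = 0\<close>.\<close>
      then have "v0 + axis i 1 \<in> ?F"
        using that v0 \<open>V \<subseteq> P\<close> up[of v0 "axis i 1"]
        by (auto simp: inner_add_right inner_axis)
      moreover have "v0 \<in> ?F"
        using v0 \<open>V \<subseteq> P\<close> by blast
      ultimately show ?thesis
        using orth[of v0] orth[of "v0 + axis i 1"] by (simp add: inner_add_right inner_axis)
    qed
    then have "d = 0"
      using orth \<open>V \<subseteq> P\<close> by (intro direction) (auto simp: inner_commute)
    with \<open>d \<noteq> 0\<close> show False ..
  qed
  then have "int DIM(real^'p) - 1 \<le> aff_dim ?F"
    by (rule aff_dim_ge_if_span_UNIV)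
  moreover have "aff_dim ?F < aff_dim P"
  proof (rule face_of_aff_dim_lt[OF \<open>convex P\<close> face])
    \<comment> \<open>Moving from \<open>v0\<close> along \<open>w\<close> itself stays in
      \<open>P\<close> because \<open>w\<close> is nonnegative, but raises the value 1 by the
      squared norm of \<open>w\<close>.\<close>
    have "v0 + w \<in> P"
      using v0 \<open>V \<subseteq> P\<close> w(2) by (auto intro!: up simp: nonneg_orthant_def)
    moreover have "w \<bullet> (v0 + w) \<noteq> 1"
      using v0 \<open>w \<noteq> 0\<close> by (simp add: inner_add_right)
    ultimately show "?F \<noteq> P"
      by blast
  qed
  ultimately have "aff_dim ?F = aff_dim P - 1"
    using aff_dim_le_DIM[of P] by linarith
  then have "?F facet_of P"
    using face v0 \<open>V \<subseteq> P\<close> by (auto simp: facet_of_def)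
  then show "facet_supporting P {y. w \<bullet> y = 1}"
    using supp by (auto simp: facet_supporting_def)
qed

section \<open>Separation of outside points by feasible weights\<close>

text \<open>Upward closure of \<open>P\<close> makes the separating normal nonnegative, and then
  nonnegativity of \<open>ystar\<close> makes the right-hand side positive.\<close>

lemma tsep_feasible_separates:
  fixes P :: "(real^'p) set"
  assumes "convex P" "closed P" "P \<noteq> {}"
    and up: "\<And>y r. y \<in> P \<Longrightarrow> r \<in> nonneg_orthant \<Longrightarrow> y + r \<in> P"
    and ystar: "\<forall>i. 1 \<le> ystar $ i" "ystar \<notin> P"
  shows "\<exists>w\<in>tsep_feasible P. ystar \<bullet> w < 1"
proof -
  obtain a b where ab: "a \<bullet> ystar < b" "\<And>y. y \<in> P \<Longrightarrow> b < a \<bullet> y"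
    using separating_hyperplane_closed_point[OF \<open>convex P\<close> \<open>closed P\<close> ystar(2)] by blast
  obtain y0 where "y0 \<in> P"
    using \<open>P \<noteq> {}\<close> by blast
  have a_nonneg: "0 \<le> a $ i" for i
  proof (rule ccontr)
    assume neg: "\<not> 0 \<le> a $ i"
    \<comment> \<open>Chosen so that \<open>a\<close> takes exactly the value \<open>b\<close> at
      \<open>y0 + axis i t\<close>, against strict separation.\<close>
    define t where "t = (a \<bullet> y0 - b) / - (a $ i)"
    have "0 \<le> t"
      using neg ab(2)[OF \<open>y0 \<in> P\<close>] by (simp add: t_def divide_nonneg_neg divide_nonpos_neg)
    then have "y0 + axis i t \<in> P"
      by (intro up \<open>y0 \<in> P\<close>) (simp add: nonneg_orthant_def axis_def)
    from ab(2)[OF this] have "b < a \<bullet> y0 + a $ i * t"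
      by (simp add: inner_add_right inner_axis)
    then show False
      using neg by (simp add: t_def)
  qed
  have "0 \<le> a \<bullet> ystar"
    using ystar(1) a_nonneg by (intro inner_nonneg_vec) (auto intro: order_trans[OF zero_le_one])
  then have "0 < b"
    using ab(1) by linarith
  have "(1 / b) *\<^sub>R a \<in> tsep_feasible P"
    using a_nonneg \<open>0 < b\<close> ab(2)
    by (auto simp: tsep_feasible_def inner_commute le_divide_eq less_imp_le)
  moreover have "ystar \<bullet> ((1 / b) *\<^sub>R a) < 1"
    using ab(1) \<open>0 < b\<close> by (simp add: inner_commute)
  ultimately show ?thesis
    by blast
qed

section \<open>The Edgeworth-Pareto hull\<close>

lemma image_subset_EP_hull: "f ` X \<subseteq> EP_hull X f"
proof
  fix y assume "y \<in> f ` X"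
  then have "y \<in> closure (convex hull (f ` X))"
    using closure_subset hull_subset[of "f ` X" convex] by blast
  moreover have "0 \<in> (nonneg_orthant :: (real^'p) set)"
    by (simp add: nonneg_orthant_def)
  ultimately show "y \<in> EP_hull X f"
    unfolding EP_hull_def using set_plus_intro[of y _ 0] by simp
qed

lemma EP_hull_upward:
  fixes r :: "real^'p"
  assumes "y \<in> EP_hull X f" and "r \<in> nonneg_orthant"
  shows "y + r \<in> EP_hull X f"
proof -
  obtain c s where "c \<in> closure (convex hull (f ` X))" "s \<in> nonneg_orthant" "y = c + s"
    using assms(1) by (auto simp: EP_hull_def elim!: set_plus_elim)
  moreover from this assms(2) have "s + r \<in> nonneg_orthant"
    by (simp add: nonneg_orthant_def)
  ultimately show ?thesis
    by (auto simp: EP_hull_def add.assoc)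
qed

lemma convex_EP_hull: "convex (EP_hull X f)"
proof -
  have "convex (nonneg_orthant :: (real^'p) set)"
    by (simp add: convex_def nonneg_orthant_def)
  then show ?thesis
    unfolding EP_hull_def by (intro convex_set_plus convex_closure convex_convex_hull)
qed

text \<open>Used for half-spaces with nonnegative normal, which reduces bounds on the hull to bounds
  on the image points.\<close>

lemma EP_hull_subset:
  assumes "f ` X \<subseteq> S" "convex S" "closed S"
    and "\<And>y r. y \<in> S \<Longrightarrow> r \<in> nonneg_orthant \<Longrightarrow> y + r \<in> S"
  shows "EP_hull X f \<subseteq> S"
proof -
  have "closure (convex hull (f ` X)) \<subseteq> S"
    using assms(1-3) by (intro closure_minimal hull_minimal)
  then show ?thesis
    using assms(4) by (auto simp: EP_hull_def elim!: set_plus_elim)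
qed

text \<open>For nonnegative \<open>w\<close> the bound passes to the closed convex hull and survives
  adding nonnegative vectors, so the linear program may be studied on the hull.\<close>

lemma tsep_feasible_EP_hull:
  fixes f :: "'x \<Rightarrow> real^'p"
  shows "tsep_feasible (EP_hull X f) = tsep_feasible (f ` X)"
proof
  show "tsep_feasible (EP_hull X f) \<subseteq> tsep_feasible (f ` X)"
    using image_subset_EP_hull[of f X] by (auto simp: tsep_feasible_def)
  show "tsep_feasible (f ` X) \<subseteq> tsep_feasible (EP_hull X f)"
  proof
    fix w assume w: "w \<in> tsep_feasible (f ` X)"
    have "EP_hull X f \<subseteq> {y. w \<bullet> y \<ge> 1}"
    proof (rule EP_hull_subset)
      show "f ` X \<subseteq> {y. w \<bullet> y \<ge> 1}"
        using w by (auto simp: tsep_feasible_def inner_commute)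
      fix y r assume "y \<in> {y. w \<bullet> y \<ge> 1}" "r \<in> (nonneg_orthant :: (real^'p) set)"
      then show "y + r \<in> {y. w \<bullet> y \<ge> 1}"
        using w inner_nonneg_vec[of w r]
        by (simp add: tsep_feasible_def nonneg_orthant_def inner_add_right)
    qed (simp_all add: convex_halfspace_ge closed_halfspace_ge)
    then show "w \<in> tsep_feasible (EP_hull X f)"
      using w by (auto simp: tsep_feasible_def inner_commute)
  qed
qed

lemma EP_hull_ge:
  assumes "\<forall>y\<in>f ` X. \<forall>i. c \<le> y $ i" and "y \<in> EP_hull X f"
  shows "c \<le> y $ i"
proof -
  have "EP_hull X f \<subseteq> {y. c \<le> y $ i}"
  proof (rule EP_hull_subset)
    show "f ` X \<subseteq> {y. c \<le> y $ i}"
      using assms(1) by blast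
    show "convex {y. c \<le> y $ i}" "closed {y. c \<le> y $ i}"
      using convex_halfspace_ge[of c "axis i (1::real)"] closed_halfspace_ge[of c "axis i (1::real)"]
      by (simp_all add: inner_axis')
  qed (auto simp: nonneg_orthant_def intro: add_increasing2)
  then show ?thesis
    using assms(2) by blast
qed

section \<open>Closedness and finite generation\<close>

text \<open>A sum of closed sets need not be closed, so closedness of the hull is drawn from its
  being a polyhedron.\<close>

lemma rational_polyhedron_closed:
  assumes "rational_polyhedron P"
  shows "closed P"
proof -
  obtain C where "P = {y. \<forall>(a, b)\<in>C. a \<bullet> y \<ge> b}"
    using assms by (auto simp: rational_polyhedron_def)
  then have "P = (\<Inter>(a, b)\<in>C. {y. a \<bullet> y \<ge> b})"
    by auto
  then show ?thesis
    by (auto intro!: closed_INT simp: closed_halfspace_ge)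
qed

lemma inner_convex_cone_hull_nonneg:
  assumes "\<And>r. r \<in> R \<Longrightarrow> 0 \<le> a \<bullet> r" and "c \<in> convex_cone hull R"
  shows "0 \<le> a \<bullet> c"
proof -
  have "convex_cone hull R \<subseteq> {x. 0 \<le> a \<bullet> x}"
    using assms(1) by (intro hull_minimal) (auto simp: convex_cone_halfspace_ge)
  then show ?thesis
    using assms(2) by blast
qed

text \<open>The lower bound on \<open>P\<close> forces the cone generators to be nonnegative. They
  then add no constraint on nonnegative \<open>w\<close>, and the points \<open>V\<close> alone
  determine the feasible region.\<close>

lemma tsep_feasible_finite_generators:
  fixes P :: "(real^'p) set"
  assumes "finitely_generated P" "P \<noteq> {}" and bound: "\<And>y i. y \<in> P \<Longrightarrow> c \<le> y $ i"
  obtains V where "finite V" "V \<noteq> {}" "V \<subseteq> P" "tsep_feasible P = tsep_feasible V"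
proof -
  obtain V R where V: "finite V" "P = convex hull V + convex_cone hull R"
    using assms(1) by (auto simp: finitely_generated_def)
  have "V \<noteq> {}"
    using V(2) \<open>P \<noteq> {}\<close> by (auto elim!: set_plus_elim)
  then obtain v0 where "v0 \<in> V"
    by blast
  have hull_V: "convex hull V \<subseteq> P"
    unfolding V(2) using set_plus_intro[of _ "convex hull V" 0 "convex_cone hull R"]
    by (auto simp: convex_cone_hull_contains_0)
  then have "V \<subseteq> P"
    using hull_subset[of V convex] by blast
  have R_nonneg: "0 \<le> r $ i" if "r \<in> R" for r i
  proof (rule ccontr)
    assume neg: "\<not> 0 \<le> r $ i"
    \<comment> \<open>Chosen so that coordinate \<open>i\<close> of
      \<open>v0 + t *\<^sub>R r\<close> equals \<open>c - 1\<close>, just below the bound.\<close>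
    define t where "t = (v0 $ i - c + 1) / - (r $ i)"
    have "c \<le> v0 $ i"
      using bound \<open>v0 \<in> V\<close> \<open>V \<subseteq> P\<close> by blast
    then have "0 \<le> t"
      using neg by (simp add: t_def divide_nonneg_neg divide_nonpos_neg)
    then have "t *\<^sub>R r \<in> convex_cone hull R"
      using that by (simp add: convex_cone_hull_mul hull_inc)
    then have "v0 + t *\<^sub>R r \<in> P"
      unfolding V(2) using \<open>v0 \<in> V\<close> by (intro set_plus_intro) (simp_all add: hull_inc)
    from bound[OF this, of i] show False
      using neg by (simp add: t_def)
  qed
  have "tsep_feasible V \<subseteq> tsep_feasible P"
  proof
    fix w assume w: "w \<in> tsep_feasible V"
    have "1 \<le> y \<bullet> w" if "y \<in> P" for y
    proof -
      obtain u s where us: "y = u + s" "u \<in> convex hull V" "s \<in> convex_cone hull R"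
        using \<open>y \<in> P\<close> V(2) by (auto elim!: set_plus_elim)
      have "convex hull V \<subseteq> {u. 1 \<le> w \<bullet> u}"
        using w by (intro hull_minimal convex_halfspace_ge)
          (auto simp: tsep_feasible_def inner_commute)
      moreover have "0 \<le> w \<bullet> s"
        using us(3) w R_nonneg inner_nonneg_vec[of w]
        by (auto simp: tsep_feasible_def intro: inner_convex_cone_hull_nonneg[of R w s])
      ultimately show ?thesis
        using us(1,2) by (auto simp: inner_add_right inner_commute[of _ w])
    qed
    then show "w \<in> tsep_feasible P"
      using w by (simp add: tsep_feasible_def)
  qed
  moreover have "tsep_feasible P \<subseteq> tsep_feasible V"
    using \<open>V \<subseteq> P\<close> by (auto simp: tsep_feasible_def)
  ultimately show thesis
    using that V(1) \<open>V \<noteq> {}\<close> \<open>V \<subseteq> P\<close> by blast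
qed

section \<open>Correctness of the oracle and the facet property\<close>

theorem theorem9:
  fixes X :: "'x set" and f :: "'x \<Rightarrow> real^'p"
  assumes "weighted_sums_finite X f"
    and "finitely_generated (EP_hull X f)"
    and "rational_polyhedron (EP_hull X f)"
    and "\<forall>y\<in>f ` X. \<forall>i. 1 \<le> y $ i"
  defines "D \<equiv> {ystar :: real^'p. \<forall>i. 1 \<le> ystar $ i}"
  shows "(\<forall>ystar\<in>D. \<exists>w. tsep_optimal_extreme (f ` X) ystar w) \<and>
         (\<forall>solve. (\<forall>ystar\<in>D. tsep_optimal_extreme (f ` X) ystar (solve ystar)) \<longrightarrow>
            point_separating_oracle_on D (EP_hull X f) (tsep_procedure solve) \<and>
            (\<forall>ystar\<in>D. \<forall>H. tsep_procedure solve ystar = (Outside, H) \<longrightarrow>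
               facet_supporting (EP_hull X f) H))"
proof -
  let ?P = "EP_hull X f"
  \<comment> \<open>The zero weight is rational and nonnegative, and an empty \<open>X\<close> would
    make its infimum infinite.\<close>
  have "X \<noteq> {}"
  proof -
    have "\<bar>INF x\<in>X. ereal (0 \<bullet> f x)\<bar> \<noteq> \<infinity>"
      using bspec[OF assms(1)[unfolded weighted_sums_finite_def], of 0]
      by (simp add: nonneg_orthant_def rational_vec_def)
    then show ?thesis
      by (auto simp: top_ereal_def)
  qed
  then have "?P \<noteq> {}"
    using image_subset_EP_hull[of f X] by blast
  obtain V where V: "finite V" "V \<noteq> {}" "V \<subseteq> ?P" "tsep_feasible ?P = tsep_feasible V"
    using tsep_feasible_finite_generators[OF assms(2) \<open>?P \<noteq> {}\<close>] EP_hull_ge[OF assms(4)] by blast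
  have feasible: "tsep_feasible (f ` X) = tsep_feasible ?P"
    by (simp add: tsep_feasible_EP_hull)
  note supp = tsep_extreme_facet_supporting[OF convex_EP_hull EP_hull_upward V]
  have "tsep_feasible (f ` X) \<noteq> {}"
    using axis_in_tsep_feasible[of "f ` X"] assms(4) by blast
  then have "\<forall>ystar\<in>D. \<exists>w. tsep_optimal_extreme (f ` X) ystar w"
    using tsep_optimal_extreme_exists by (auto simp: D_def)
  moreover have "point_separating_oracle_on D ?P (tsep_procedure solve) \<and>
      (\<forall>ystar\<in>D. \<forall>H. tsep_procedure solve ystar = (Outside, H) \<longrightarrow> facet_supporting ?P H)"
    if solve: "\<forall>ystar\<in>D. tsep_optimal_extreme (f ` X) ystar (solve ystar)" for solve
  proof (intro conjI ballI allI impI)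
    have ext: "solve ystar extreme_point_of tsep_feasible ?P" if "ystar \<in> D" for ystar
      using solve that by (auto simp: tsep_optimal_extreme_def feasible)
    then have in_feasible: "solve ystar \<in> tsep_feasible ?P" if "ystar \<in> D" for ystar
      using that by (auto simp: extreme_point_of_def)
    show "point_separating_oracle_on D ?P (tsep_procedure solve)"
      unfolding point_separating_oracle_on_def
    proof (intro ballI conjI impI)
      fix ystar assume "ystar \<in> D" "ystar \<in> ?P"
      \<comment> \<open>A feasible weight has value at least 1 at every point of the hull, so the
        test for outside fails.\<close>
      then show "tsep_procedure solve ystar = (Inside, {})"
        using in_feasible[of ystar] by (force simp: tsep_procedure_def Let_def tsep_feasible_def)
    next
      fix ystar assume ystar: "ystar \<in> D" "ystar \<notin> ?P"
      have "\<exists>w\<in>tsep_feasible ?P. ystar \<bullet> w < 1"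
        using ystar \<open>?P \<noteq> {}\<close>
        by (intro tsep_feasible_separates convex_EP_hull EP_hull_upward
            rational_polyhedron_closed[OF assms(3)]) (auto simp: D_def)
      \<comment> \<open>By optimality, the value at \<open>solve ystar\<close> is at most that of
        the separating weight.\<close>
      then have "ystar \<bullet> solve ystar < 1"
        using solve ystar(1) by (force simp: tsep_optimal_extreme_def feasible)
      then show "\<exists>w \<alpha>. tsep_procedure solve ystar = (Outside, {y. w \<bullet> y = \<alpha>}) \<and>
          supporting_hyperplane ?P w \<alpha> \<and> w \<bullet> ystar < \<alpha> \<and> (\<forall>y\<in>?P. w \<bullet> y \<ge> \<alpha>)"
        using supp(1)[OF _ _ ext[OF ystar(1)]]
        by (intro exI[of _ "solve ystar"] exI[of _ 1])
          (auto simp: tsep_procedure_def Let_def inner_commute supporting_hyperplane_def)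
    qed
    fix ystar H assume "ystar \<in> D" "tsep_procedure solve ystar = (Outside, H)"
    then show "facet_supporting ?P H"
      using supp(2)[OF _ _ ext] by (auto simp: tsep_procedure_def Let_def split: if_splits)
  qed
  ultimately show ?thesis
    by blast
qed

end
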